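(* Let $G$ be a finite simple graph with $\mathrm{mad}(G)\le 3$. Then $\chi^t_{\mathrm M}(G)\le 2$; that is, there is a map $\ell: V(G)\cup E(G)\to\{1,2\}$ such that for every edge $uv$ of $G$ we have $\mu_\ell(u)\neq\mu_\ell(v)$, where $\mu_\ell(w)$ is the multiset consisting of $\ell(w)$ together with $\ell(wx)$ for all $x\in N(w)$.
   Context: A total $k$-labelling of a graph $G$ is a map $\ell: V(G)\cup E(G)\to\{1,\dots,k\}$. For a vertex $w$, $\mu_\ell(w)$ is the multiset of labels consisting of the label of $w$ and the labels of all edges incident to $w$. The labelling is multiset-proper if $\mu_\ell(u)\ne\mu_\ell(v)$ for every edge $uv$. $\chi^t_{\mathrm M}(G)$ is the smallest $k\ge1$ such that $G$ admits a multiset-proper total $k$-labelling. The average degree of a graph $H$ is $2|E(H)|/|V(H)|$, and the maximum average degree $\mathrm{mad}(G)$ is the maximum of the average degree over all (not necessarily induced) nonempty subgraphs $H$ of $G$. *)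

theory Defs
  imports Complex_Main "HOL-Library.Multiset" "HOL-Library.FuncSet"
begin

text \<open>
  A finite simple graph is given by its vertex set \<open>V\<close> and its set \<open>E\<close> of edges; the edge
  between \<open>u\<close> and \<open>v\<close> is the two-element set \<open>{u, v}\<close>. The graph without vertices is allowed.
\<close>

definition finite_simple_graph :: "'a set \<Rightarrow> 'a set set \<Rightarrow> bool" where
  "finite_simple_graph V E \<longleftrightarrow> finite V \<and> (\<forall>e\<in>E. e \<subseteq> V \<and> card e = 2)"

definition subgraph :: "'a set \<Rightarrow> 'a set set \<Rightarrow> 'a set \<Rightarrow> 'a set set \<Rightarrow> bool" where
  "subgraph W F V E \<longleftrightarrow> W \<subseteq> V \<and> F \<subseteq> E \<and> (\<forall>e\<in>F. e \<subseteq> W)"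

definition average_degree :: "'a set \<Rightarrow> 'a set set \<Rightarrow> real" where
  "average_degree V E = 2 * real (card E) / real (card V)"

text \<open>
  The graph without vertices has no nonempty subgraph; its maximum average degree is set to 0.
\<close>

definition mad :: "'a set \<Rightarrow> 'a set set \<Rightarrow> real" where
  "mad V E =
    (if V = {} then 0
     else Max {average_degree W F | W F. subgraph W F V E \<and> W \<noteq> {}})"

text \<open>
  A total labelling is a function on the disjoint union of vertices and edges, so the label of a
  vertex \<open>v\<close> is \<open>l (Inl v)\<close> and the label of an edge \<open>e\<close> is \<open>l (Inr e)\<close>. Values outside
  \<open>V <+> E\<close> are irrelevant.
\<close>

definition total_labelling :: "'a set \<Rightarrow> 'a set set \<Rightarrow> nat \<Rightarrow> ('a + 'a set \<Rightarrow> nat) \<Rightarrow> bool" where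
  "total_labelling V E k l \<longleftrightarrow> l \<in> (V <+> E) \<rightarrow> {1..k}"

definition label_mset :: "'a set set \<Rightarrow> ('a + 'a set \<Rightarrow> nat) \<Rightarrow> 'a \<Rightarrow> nat multiset" where
  "label_mset E l w = add_mset (l (Inl w)) (image_mset (\<lambda>e. l (Inr e)) (mset_set {e \<in> E. w \<in> e}))"

definition multiset_proper :: "'a set set \<Rightarrow> ('a + 'a set \<Rightarrow> nat) \<Rightarrow> bool" where
  "multiset_proper E l \<longleftrightarrow> (\<forall>u v. {u, v} \<in> E \<longrightarrow> label_mset E l u \<noteq> label_mset E l v)"

definition chi_total_M :: "'a set \<Rightarrow> 'a set set \<Rightarrow> nat" where
  "chi_total_M V E =
    (LEAST k. 1 \<le> k \<and> (\<exists>l. total_labelling V E k l \<and> multiset_proper E l))"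

lemma finite_simple_graph_finite_edges:
  assumes "finite_simple_graph V E"
  shows "finite E"
proof (rule finite_subset)
  show "E \<subseteq> Pow V" using assms by (auto simp: finite_simple_graph_def)
  show "finite (Pow V)" using assms by (simp add: finite_simple_graph_def)
qed

text \<open>The maximum in \<open>mad\<close> is attained, and the least number in \<open>chi_total_M\<close> exists.\<close>

lemma finite_average_degrees:
  assumes "finite_simple_graph V E"
  shows "finite {average_degree W F | W F. subgraph W F V E \<and> W \<noteq> {}}"
proof (rule finite_subset)
  show "{average_degree W F | W F. subgraph W F V E \<and> W \<noteq> {}}
      \<subseteq> (\<lambda>(W, F). average_degree W F) ` (Pow V \<times> Pow E)"
    by (auto simp: subgraph_def)
  show "finite ((\<lambda>(W, F). average_degree W F) ` (Pow V \<times> Pow E))"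
    using assms finite_simple_graph_finite_edges[OF assms]
    by (simp add: finite_simple_graph_def)
qed

lemma average_degrees_nonempty:
  assumes "V \<noteq> {}"
  shows "{average_degree W F | W F. subgraph W F V E \<and> W \<noteq> {}} \<noteq> {}"
proof -
  have "subgraph V {} V E" by (simp add: subgraph_def)
  with assms show ?thesis by blast
qed

lemma multiset_proper_labelling_exists:
  assumes "finite_simple_graph V E"
  shows "\<exists>k\<ge>1. \<exists>l. total_labelling V E k l \<and> multiset_proper E l"
proof -
  have "finite V" using assms by (simp add: finite_simple_graph_def)
  then obtain f :: "'a \<Rightarrow> nat" and n where f: "f ` V = {i. i < n}" "inj_on f V"
    using finite_imp_inj_to_nat_seg by metis
  define l :: "'a + 'a set \<Rightarrow> nat" where "l = case_sum (\<lambda>v. Suc (f v)) (\<lambda>e. 1)"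
  have "f v < n" if "v \<in> V" for v using f(1) that by blast
  then have "total_labelling V E (Suc n) l"
    by (auto simp: total_labelling_def l_def less_imp_le)
  moreover have "multiset_proper E l"
    unfolding multiset_proper_def
  proof (intro allI impI notI)
    fix u v
    assume uv: "{u, v} \<in> E" and eq: "label_mset E l u = label_mset E l v"
    have "u \<in> V" "v \<in> V" "card {u, v} = 2"
      using assms uv by (auto simp: finite_simple_graph_def)
    then have "f u \<noteq> f v" using f(2) by (auto simp: inj_on_eq_iff)
    moreover have "sum_mset (label_mset E l w) = Suc (f w) + (size (label_mset E l w) - 1)" for w
      by (simp add: label_mset_def l_def)
    ultimately show False using eq by (metis add_right_cancel Suc_inject)
  qed
  ultimately show ?thesis by (intro exI[of _ "Suc n"]) auto
qed

end

theory Submission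
  imports Defs
begin

text \<open>
  Call an edge selected if its label is 2, and let \<open>t v\<close> be the number of selected edges at \<open>v\<close>, plus
  one if \<open>v\<close> itself is labelled 2. It suffices that \<open>t\<close> separates adjacent vertices.

  Repeatedly deleting a vertex with at most two remaining neighbours leaves, because
  of \<open>mad V E \<le> 3\<close>, a cubic graph on a set \<open>C\<close>. A maximum cut splits \<open>C\<close> into two sides, each inducing
  a matching. Put the deleted vertices back in reverse order: a vertex without neighbour in \<open>A\<close> joins
  \<open>A\<close>; any other one joins \<open>Y\<close> and has at most one neighbour there. So the only edges inside \<open>A\<close> form
  a matching in \<open>C\<close>, every vertex of \<open>Y\<close> has a neighbour in \<open>A\<close>, and the graph on \<open>Y\<close> is a forest
  each of whose components contains at most one vertex or edge of \<open>C\<close>.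

  Make \<open>t\<close> even on \<open>A\<close> and odd on \<open>Y\<close>. The vertex labels take care of the parity on \<open>A\<close>, so every
  vertex of \<open>Y\<close> may freely use its edges to \<open>A\<close>. Selecting edges of the forest such that all
  degrees are odd except at the roots, one can prescribe \<open>t\<close> modulo 4 on each component, with the
  values 1 and 3 alternating. The remaining conflicts are at the edges inside \<open>A\<close>. By Hall's theorem,
  such an edge \<open>m\<close> with endpoint \<open>\<alpha> m\<close> gets a private neighbour \<open>\<beta> m\<close> of \<open>\<alpha> m\<close> in \<open>Y \<inter> C\<close>, in a
  component of its own. As the alternation in that component may be started at either value, the
  edge from \<open>\<alpha> m\<close> to \<open>\<beta> m\<close> can be exchanged for the label of \<open>\<beta> m\<close>, and this choice
  resolves the conflict at \<open>m\<close>.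
\<close>

section \<open>Hall's marriage theorem\<close>

text \<open>Induction on \<open>card I\<close>: a proper nonempty subset without slack in Hall's
  condition is matched inside its own union and the rest outside it; if there is none, any single
  choice can be fixed first.\<close>

theorem hall_marriage:
  assumes "finite I" "\<And>i. i \<in> I \<Longrightarrow> finite (S i)"
    and "\<And>J. J \<subseteq> I \<Longrightarrow> card J \<le> card (\<Union>(S ` J))"
  shows "\<exists>R. inj_on R I \<and> (\<forall>i\<in>I. R i \<in> S i)"
  using assms
proof (induction "card I" arbitrary: I S rule: less_induct)
  case less
  note fin = less.prems(1) and finS = less.prems(2) and hall = less.prems(3)
  show ?case
  proof (cases "\<exists>J. J \<subset> I \<and> J \<noteq> {} \<and> card (\<Union>(S ` J)) \<le> card J")
    case True
    then obtain J where J: "J \<subset> I" "J \<noteq> {}" "card (\<Union>(S ` J)) \<le> card J" by blast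
    have finJ: "finite J" using J(1) fin by (meson finite_subset psubset_imp_subset)
    let ?T = "\<Union>(S ` J)"
    have finT: "finite ?T" using finJ J(1) finS by blast
    have "card J < card I" using J(1) fin by (rule psubset_card_mono[rotated])
    then have "\<exists>R. inj_on R J \<and> (\<forall>i\<in>J. R i \<in> S i)"
    proof (rule less.hyps)
      fix K assume "K \<subseteq> J"
      then show "card K \<le> card (\<Union>(S ` K))" using J(1) by (intro hall) blast
    qed (use finJ finS J(1) in auto)
    then obtain R1 where R1: "inj_on R1 J" "\<forall>i\<in>J. R1 i \<in> S i" by blast
    have "\<exists>R. inj_on R (I - J) \<and> (\<forall>i\<in>I - J. R i \<in> S i - ?T)"
    proof (rule less.hyps)
      show "card (I - J) < card I" using J fin by (intro psubset_card_mono) auto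
      fix K assume K: "K \<subseteq> I - J"
      have finK: "finite K" using K fin by (meson finite_Diff finite_subset)
      let ?U = "\<Union>((\<lambda>i. S i - ?T) ` K)"
      have finU: "finite ?U" using finK K finS by blast
      \<comment> \<open>Since \<open>?T\<close> has at most \<open>card J\<close> elements, Hall's
        condition for \<open>J \<union> K\<close> leaves at least \<open>card K\<close> elements
        outside \<open>?T\<close>.\<close>
      have "card J + card K = card (J \<union> K)" using finJ finK K by (subst card_Un_disjoint) auto
      also have "\<dots> \<le> card (\<Union>(S ` (J \<union> K)))" using K J by (intro hall) auto
      also have "\<Union>(S ` (J \<union> K)) = ?T \<union> ?U" by auto
      also have "card \<dots> = card ?T + card ?U" using finT finU by (intro card_Un_disjoint) auto
      finally show "card K \<le> card ?U" using J(3) by linarith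
    qed (use fin finS in auto)
    then obtain R2 where R2: "inj_on R2 (I - J)" "\<forall>i\<in>I - J. R2 i \<in> S i - ?T" by blast
    let ?R = "\<lambda>i. if i \<in> J then R1 i else R2 i"
    have "inj_on ?R I"
    proof (rule inj_onI)
      fix i j assume ij: "i \<in> I" "j \<in> I" "?R i = ?R j"
      have "R1 k \<in> ?T" if "k \<in> J" for k using R1(2) that by blast
      then show "i = j" using ij R1(1) R2
        by (smt (verit) Diff_iff inj_on_eq_iff)
    qed
    moreover have "\<forall>i\<in>I. ?R i \<in> S i" using R1 R2 by auto
    ultimately show ?thesis by blast
  next
    case False
    show ?thesis
    proof (cases "I = {}")
      case True then show ?thesis by simp
    next
      case False': False
      then obtain i where i: "i \<in> I" by blast
      have "card {i} \<le> card (S i)" using hall[of "{i}"] i by simp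
      then obtain x where x: "x \<in> S i" by fastforce
      have "\<exists>R. inj_on R (I - {i}) \<and> (\<forall>j\<in>I - {i}. R j \<in> S j - {x})"
      proof (rule less.hyps)
        show "card (I - {i}) < card I" using i fin by (meson card_Diff1_less)
        fix K assume K: "K \<subseteq> I - {i}"
        show "card K \<le> card (\<Union>((\<lambda>j. S j - {x}) ` K))"
        proof (cases "K = {}")
          case False'': False
          have "K \<subset> I" using K i by blast
          \<comment> \<open>Strictness, available for a proper nonempty subset, pays for the loss of
            \<open>x\<close>.\<close>
          then have "card K < card (\<Union>(S ` K))" using False False'' by (meson not_le)
          moreover have "\<Union>((\<lambda>j. S j - {x}) ` K) = \<Union>(S ` K) - {x}" by auto
          ultimately have "card K \<le> card (\<Union>(S ` K)) - 1" by linarith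
          then show ?thesis using \<open>\<Union>((\<lambda>j. S j - {x}) ` K) = \<Union>(S ` K) - {x}\<close>
            by (metis card_Diff_singleton_if diff_le_self le_trans)
        qed simp
      qed (use fin finS in auto)
      then obtain R where R: "inj_on R (I - {i})" "\<forall>j\<in>I - {i}. R j \<in> S j - {x}" by blast
      have "inj_on (R(i := x)) I" using R unfolding inj_on_def by auto
      moreover have "\<forall>j\<in>I. (R(i := x)) j \<in> S j" using R x by auto
      ultimately show ?thesis by blast
    qed
  qed
qed

section \<open>Degrees and cuts\<close>

definition nbrs :: "'a set set \<Rightarrow> 'a \<Rightarrow> 'a set" where
  "nbrs E v = {u. {u, v} \<in> E}"

definition inc :: "'a set set \<Rightarrow> 'a \<Rightarrow> nat" where
  "inc F v = card {e \<in> F. v \<in> e}"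

lemma nbrs_sym: "u \<in> nbrs E v \<longleftrightarrow> v \<in> nbrs E u"
  by (simp add: nbrs_def insert_commute)

lemma nbrs_subset:
  assumes "finite_simple_graph V E"
  shows "nbrs E v \<subseteq> V - {v}"
  using assms by (fastforce simp: nbrs_def finite_simple_graph_def)

lemma finite_nbrs: "finite_simple_graph V E \<Longrightarrow> finite (nbrs E v)"
  by (meson nbrs_subset finite_simple_graph_def finite_Diff finite_subset)

lemma inc_eq_card_nbrs:
  assumes "\<And>e. e \<in> F \<Longrightarrow> card e = 2"
  shows "inc F v = card (nbrs F v)"
proof -
  have "bij_betw (\<lambda>u. {u, v}) (nbrs F v) {e \<in> F. v \<in> e}"
  proof (rule bij_betw_imageI)
    show "inj_on (\<lambda>u. {u, v}) (nbrs F v)" by (auto simp: inj_on_def doubleton_eq_iff)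
    show "(\<lambda>u. {u, v}) ` nbrs F v = {e \<in> F. v \<in> e}"
    proof (intro equalityI subsetI)
      fix e assume e: "e \<in> {e \<in> F. v \<in> e}"
      then obtain a b where "e = {a, b}" using assms[of e] by (auto simp: card_2_iff)
      then show "e \<in> (\<lambda>u. {u, v}) ` nbrs F v" using e by (auto simp: nbrs_def insert_commute)
    qed (auto simp: nbrs_def)
  qed
  then show ?thesis by (simp add: inc_def bij_betw_same_card)
qed

text \<open>For nonempty \<open>W\<close>, the subgraph induced by \<open>W\<close> is one of those
  over which the maximum is taken.\<close>

lemma mad_le_3_imp_sparse:
  assumes "finite_simple_graph V E" and "mad V E \<le> 3" and "W \<subseteq> V"
  shows "2 * card {e \<in> E. e \<subseteq> W} \<le> 3 * card W"
proof (cases "W = {}")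
  case True
  then have "{e \<in> E. e \<subseteq> W} = {}" using assms(1) by (auto simp: finite_simple_graph_def)
  then show ?thesis by (metis card.empty mult_0_right zero_le)
next
  case False
  let ?F = "{e \<in> E. e \<subseteq> W}"
  have fW: "finite W" using assms(1,3) by (meson finite_simple_graph_def finite_subset)
  have sub: "subgraph W ?F V E" using assms(3) by (auto simp: subgraph_def)
  have "V \<noteq> {}" using False assms(3) by blast
  then have "average_degree W ?F \<le> mad V E"
    unfolding mad_def using sub False finite_average_degrees[OF assms(1)] by (auto intro!: Max_ge)
  then have "2 * real (card ?F) / real (card W) \<le> 3" using assms(2) by (simp add: average_degree_def)
  moreover have "card W > 0" using False fW by (simp add: card_gt_0_iff)
  ultimately have "2 * real (card ?F) \<le> 3 * real (card W)" by (simp add: field_simps)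
  then show ?thesis by linarith
qed

lemma handshake:
  assumes "finite W" "finite F" "\<And>e. e \<in> F \<Longrightarrow> e \<subseteq> W \<and> card e = 2"
  shows "(\<Sum>v\<in>W. inc F v) = 2 * card F"
proof -
  have "(\<Sum>v\<in>W. inc F v) = (\<Sum>v\<in>W. \<Sum>e | e \<in> F \<and> v \<in> e. 1)" by (simp add: inc_def)
  also have "\<dots> = (\<Sum>e\<in>F. \<Sum>v | v \<in> W \<and> v \<in> e. 1)" using assms by (intro sum.swap_restrict)
  also have "\<dots> = (\<Sum>e\<in>F. 2)"
  proof (rule sum.cong)
    fix e assume "e \<in> F"
    then have "{v \<in> W. v \<in> e} = e" "card e = 2" using assms by auto
    then show "(\<Sum>v | v \<in> W \<and> v \<in> e. 1) = (2::nat)" by simp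
  qed simp
  finally show ?thesis by simp
qed

text \<open>By sparsity the degrees within \<open>W\<close> sum to at most
  \<open>3 * card W\<close>, so none of them can exceed the lower bound 3.\<close>

lemma cubic_if_min_degree_3:
  assumes G: "finite_simple_graph V E" and mad: "mad V E \<le> 3" and W: "W \<subseteq> V"
    and deg: "\<And>v. v \<in> W \<Longrightarrow> 3 \<le> card (nbrs E v \<inter> W)" and v: "v \<in> W"
  shows "card (nbrs E v \<inter> W) = 3"
proof -
  let ?F = "{e \<in> E. e \<subseteq> W}"
  have fin: "finite W" "finite ?F"
    using W G finite_simple_graph_finite_edges[OF G]
    by (auto simp: finite_simple_graph_def intro: finite_subset)
  have "inc ?F u = card (nbrs ?F u)" for u
    using G by (intro inc_eq_card_nbrs) (auto simp: finite_simple_graph_def)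
  moreover have "nbrs ?F u = nbrs E u \<inter> W" if "u \<in> W" for u
    using that by (auto simp: nbrs_def)
  ultimately have inc: "inc ?F u = card (nbrs E u \<inter> W)" if "u \<in> W" for u
    using that by simp
  have "(\<Sum>u\<in>W. inc ?F u) = 2 * card ?F"
    using G fin by (intro handshake) (auto simp: finite_simple_graph_def)
  also have "\<dots> \<le> (\<Sum>u\<in>W. 3)" using mad_le_3_imp_sparse[OF G mad W] by simp
  finally have le: "(\<Sum>u\<in>W. inc ?F u) \<le> (\<Sum>u\<in>W. 3)" .
  show ?thesis
  proof (rule ccontr)
    assume "\<not> ?thesis"
    then have "3 < inc ?F v" using deg[OF v] inc[OF v] by linarith
    then have "(\<Sum>u\<in>W. 3) < (\<Sum>u\<in>W. inc ?F u)"
      using fin v deg inc by (intro sum_strict_mono_ex1) auto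
    then show False using le by linarith
  qed
qed

text \<open>Moving \<open>v\<close> to the other side loses the pairs in \<open>?P\<close>, gains
  those in \<open>?Q\<close> and keeps \<open>?X\<close>; maximality forbids a net gain.\<close>

lemma maximum_cut_exchange:
  assumes fin: "finite C"
    and adj: "\<And>u v. r u v \<Longrightarrow> r v u" and irr: "\<And>u. \<not> r u u" and S: "S \<subseteq> C"
    and max: "\<And>T. T \<subseteq> C \<Longrightarrow>
      card {(u, w). u \<in> T \<and> w \<in> C - T \<and> r u w} \<le> card {(u, w). u \<in> S \<and> w \<in> C - S \<and> r u w}"
    and v: "v \<in> S"
  shows "card {u \<in> S. r u v} \<le> card {u \<in> C - S. r u v}"
proof -
  define D where "D T = {(u, w). u \<in> T \<and> w \<in> C - T \<and> r u w}" for T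
  let ?X = "{(u, w). u \<in> S - {v} \<and> w \<in> C - S \<and> r u w}"
  let ?P = "Pair v ` {u \<in> C - S. r u v}" and ?Q = "(\<lambda>u. (u, v)) ` {u \<in> S. r u v}"
  have finX: "finite ?X"
    by (rule finite_subset[of _ "C \<times> C"]) (use S fin in auto)
  have finS: "finite S" using S fin by (rule finite_subset)
  have 1: "D S = ?X \<union> ?P" using v adj by (auto simp: D_def)
  have 2: "D (S - {v}) = ?X \<union> ?Q" using v irr S by (auto simp: D_def)
  have "card (?X \<union> ?P) = card ?X + card ?P"
    using finX fin by (intro card_Un_disjoint) auto
  moreover have "card (?X \<union> ?Q) = card ?X + card ?Q"
    using finX finS v by (intro card_Un_disjoint) auto
  moreover have "card ?P = card {u \<in> C - S. r u v}" "card ?Q = card {u \<in> S. r u v}"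
    by (auto intro!: card_image simp: inj_on_def)
  moreover have "card (D (S - {v})) \<le> card (D S)"
    using max[of "S - {v}"] S by (auto simp: D_def)
  ultimately show ?thesis using 1 2 by simp
qed

text \<open>A maximum cut has this property. The complement of its side cuts the same pairs
  reversed, hence is maximum too, which covers the other side.\<close>

lemma maximum_cut:
  assumes fin: "finite C" and adj: "\<And>u v. r u v \<Longrightarrow> r v u" and irr: "\<And>u. \<not> r u u"
  obtains S where "S \<subseteq> C"
    "\<And>v. v \<in> S \<Longrightarrow> card {u \<in> S. r u v} \<le> card {u \<in> C - S. r u v}"
    "\<And>v. v \<in> C - S \<Longrightarrow> card {u \<in> C - S. r u v} \<le> card {u \<in> S. r u v}"
proof -
  define D where "D T = {(u, w). u \<in> T \<and> w \<in> C - T \<and> r u w}" for T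
  have "finite ((\<lambda>T. card (D T)) ` Pow C)" "(\<lambda>T. card (D T)) ` Pow C \<noteq> {}" using fin by auto
  from Max_in[OF this] obtain S where S: "S \<subseteq> C" "card (D S) = Max ((\<lambda>T. card (D T)) ` Pow C)"
    by auto
  have max: "card (D T) \<le> card (D S)" if "T \<subseteq> C" for T
    using that fin S(2) by (simp add: Max_ge)
  have swap: "card (D (C - T)) = card (D T)" if "T \<subseteq> C" for T
  proof -
    have "D (C - T) = prod.swap ` D T" using that adj by (force simp: D_def)
    then show ?thesis by (simp add: card_image)
  qed
  show thesis
  proof (rule that)
    fix v assume "v \<in> S"
    then show "card {u \<in> S. r u v} \<le> card {u \<in> C - S. r u v}"
      using fin adj irr S(1) max unfolding D_def by (intro maximum_cut_exchange)
  next
    fix v assume v: "v \<in> C - S"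
    have "card {u \<in> C - S. r u v} \<le> card {u \<in> C - (C - S). r u v}"
    proof (rule maximum_cut_exchange[OF fin])
      fix T assume "T \<subseteq> C"
      then show "card {(u, w). u \<in> T \<and> w \<in> C - T \<and> r u w}
          \<le> card {(u, w). u \<in> C - S \<and> w \<in> C - (C - S) \<and> r u w}"
        using max[of T] swap[OF S(1)] by (simp add: D_def)
    qed (use adj irr v in auto)
    then show "card {u \<in> C - S. r u v} \<le> card {u \<in> S. r u v}"
      using S(1) by (simp add: double_diff)
  qed (rule S(1))
qed

section \<open>Decomposition of sparse graphs\<close>

text \<open>The last two assumptions are the only consequences needed of the fact that the graph on \<open>Y\<close> is a
  forest whose components are rooted at their vertices in \<open>C\<close>, or at one vertex if there are none;
  \<open>R\<close> is the set of roots.\<close>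

locale decomposed_graph =
  fixes E :: "'a set set" and W A Y C R :: "'a set"
  assumes card_edge: "e \<in> E \<Longrightarrow> card e = 2"
    and finite_W: "finite W"
    and W_eq: "W = A \<union> Y" and A_Y: "A \<inter> Y = {}"
    and core_subset: "C \<subseteq> W" and core_roots: "Y \<inter> C \<subseteq> R" and roots_subset: "R \<subseteq> Y"
    and core_cubic: "v \<in> C \<Longrightarrow> card (nbrs E v \<inter> C) = 3"
    and core_A: "v \<in> A \<inter> C \<Longrightarrow> card (nbrs E v \<inter> (A \<inter> C)) \<le> 1"
    and core_Y: "v \<in> Y \<inter> C \<Longrightarrow> card (nbrs E v \<inter> (Y \<inter> C)) \<le> 1"
    and A_edge: "u \<in> A \<Longrightarrow> v \<in> A \<Longrightarrow> {u, v} \<in> E \<Longrightarrow> u \<in> C"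
    and A_dominating: "v \<in> Y \<Longrightarrow> nbrs E v \<inter> A \<noteq> {}"
    and parity_subgraph: "\<exists>F. F \<subseteq> E \<and> F \<subseteq> Pow Y \<and> (\<forall>v\<in>Y - R. odd (inc F v) \<longleftrightarrow> p v)"
    and colouring_extends: "(\<And>u v. u \<in> Y \<inter> C \<Longrightarrow> v \<in> Y \<inter> C \<Longrightarrow> {u, v} \<in> E \<Longrightarrow> c u \<noteq> c v) \<Longrightarrow>
      \<exists>d :: 'a \<Rightarrow> bool. (\<forall>v\<in>R. d v = c v) \<and> (\<forall>u\<in>Y. \<forall>v\<in>Y. {u, v} \<in> E \<longrightarrow> d u \<noteq> d v)"

text \<open>In a maximum cut at most one of the three neighbours of a vertex lies on its own side.
  Taking all of \<open>Y\<close> as roots makes the parity condition vacuous and lets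
  \<open>c\<close> be its own extension.\<close>

lemma decomposed_graph_core:
  assumes G: "finite_simple_graph V E" and C: "C \<subseteq> V"
    and cubic: "\<And>v. v \<in> C \<Longrightarrow> card (nbrs E v \<inter> C) = 3"
  shows "\<exists>A Y. decomposed_graph E C A Y C Y"
proof -
  have finC: "finite C" using G C by (auto simp: finite_simple_graph_def intro: finite_subset)
  have "\<not> {u, u} \<in> E" for u using G by (auto simp: finite_simple_graph_def)
  from maximum_cut[OF finC, of "\<lambda>u v. {u, v} \<in> E", OF _ this]
  obtain A where A: "A \<subseteq> C"
    "\<And>v. v \<in> A \<Longrightarrow> card {u \<in> A. {u, v} \<in> E} \<le> card {u \<in> C - A. {u, v} \<in> E}"
    "\<And>v. v \<in> C - A \<Longrightarrow> card {u \<in> C - A. {u, v} \<in> E} \<le> card {u \<in> A. {u, v} \<in> E}"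
    by (auto simp: insert_commute)
  have eq: "{u \<in> S. {u, v} \<in> E} = nbrs E v \<inter> S" for S v by (auto simp: nbrs_def)
  have split: "card (nbrs E v \<inter> A) + card (nbrs E v \<inter> (C - A)) = 3" if "v \<in> C" for v
  proof -
    have "card (nbrs E v \<inter> C) = card ((nbrs E v \<inter> A) \<union> (nbrs E v \<inter> (C - A)))"
      using A(1) by (intro arg_cong[where f = card]) auto
    also have "\<dots> = card (nbrs E v \<inter> A) + card (nbrs E v \<inter> (C - A))"
      using finite_nbrs[OF G] by (intro card_Un_disjoint) auto
    finally show ?thesis using cubic[OF that] by simp
  qed
  have inY: "card (nbrs E v \<inter> (C - A)) \<le> 1" if "v \<in> C - A" for v
    using A(3)[OF that] split[of v] that unfolding eq by auto
  have inA: "card (nbrs E v \<inter> A) \<le> 1" if "v \<in> A" for v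
    using A(2)[OF that] split[of v] that A(1) unfolding eq by auto
  have dom: "nbrs E v \<inter> A \<noteq> {}" if "v \<in> C - A" for v
    using inY[OF that] split[of v] that by auto
  have AC: "A \<inter> C = A" "(C - A) \<inter> C = C - A" using A(1) by auto
  have "decomposed_graph E C A (C - A) C (C - A)"
  proof unfold_locales
    fix c :: "'a \<Rightarrow> bool"
    assume "\<And>u v. u \<in> (C - A) \<inter> C \<Longrightarrow> v \<in> (C - A) \<inter> C \<Longrightarrow> {u, v} \<in> E \<Longrightarrow> c u \<noteq> c v"
    then show "\<exists>d. (\<forall>v\<in>C - A. d v = c v) \<and>
        (\<forall>u\<in>C - A. \<forall>v\<in>C - A. {u, v} \<in> E \<longrightarrow> d u \<noteq> d v)"
      by (intro exI[of _ c]) auto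
  qed (use G finC A(1) cubic inA inY dom AC in \<open>auto simp: finite_simple_graph_def\<close>)
  then show ?thesis by blast
qed

text \<open>The new vertex lies outside \<open>C\<close> and creates no edge inside
  \<open>A\<close>, while \<open>Y\<close> stays as it is.\<close>

lemma decomposed_graph_insert_A:
  assumes "decomposed_graph E W A Y C R" and n: "n \<notin> W" and irr: "{n, n} \<notin> E"
    and nA: "nbrs E n \<inter> A = {}"
  shows "decomposed_graph E (insert n W) (insert n A) Y C R"
proof -
  interpret decomposed_graph E W A Y C R by fact
  have nC: "n \<notin> C" using n core_subset by auto
  then have AC: "insert n A \<inter> C = A \<inter> C" by auto
  have nA': "{u, n} \<notin> E" "{n, u} \<notin> E" if "u \<in> A" for u
    using nA that by (auto simp: nbrs_def insert_commute)
  show ?thesis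
  proof unfold_locales
    fix u v assume "u \<in> insert n A" "v \<in> insert n A" "{u, v} \<in> E"
    then show "u \<in> C" using A_edge nA' irr by auto
  next
    fix v assume "v \<in> Y"
    then show "nbrs E v \<inter> insert n A \<noteq> {}" using A_dominating by auto
  next
    fix v assume "v \<in> insert n A \<inter> C"
    then show "card (nbrs E v \<inter> (insert n A \<inter> C)) \<le> 1" using core_A unfolding AC by blast
  next
    fix c :: "'a \<Rightarrow> bool"
    assume "\<And>u v. u \<in> Y \<inter> C \<Longrightarrow> v \<in> Y \<inter> C \<Longrightarrow> {u, v} \<in> E \<Longrightarrow> c u \<noteq> c v"
    then show "\<exists>d. (\<forall>v\<in>R. d v = c v) \<and> (\<forall>u\<in>Y. \<forall>v\<in>Y. {u, v} \<in> E \<longrightarrow> d u \<noteq> d v)"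
      by (rule colouring_extends)
  qed (use card_edge finite_W W_eq A_Y core_subset core_roots roots_subset core_cubic core_Y
      parity_subgraph n in auto)
qed

text \<open>The new vertex is a component of its own: as a root it carries no parity condition, and
  its colour can be set to \<open>c n\<close>.\<close>

lemma decomposed_graph_insert_root:
  assumes "decomposed_graph E W A Y C R" and n: "n \<notin> W" and irr: "{n, n} \<notin> E"
    and nA: "nbrs E n \<inter> A \<noteq> {}" and nY: "nbrs E n \<inter> Y = {}"
  shows "decomposed_graph E (insert n W) A (insert n Y) C (insert n R)"
proof -
  interpret decomposed_graph E W A Y C R by fact
  have nC: "n \<notin> C" using n core_subset by auto
  then have YC: "insert n Y \<inter> C = Y \<inter> C" by auto
  have nY': "{u, n} \<notin> E" "{n, u} \<notin> E" if "u \<in> Y" for u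
    using nY that by (auto simp: nbrs_def insert_commute)
  show ?thesis
  proof unfold_locales
    fix p
    obtain F where "F \<subseteq> E" "F \<subseteq> Pow Y" "\<forall>v\<in>Y - R. odd (inc F v) \<longleftrightarrow> p v"
      using parity_subgraph[of p] by blast
    then show "\<exists>F. F \<subseteq> E \<and> F \<subseteq> Pow (insert n Y) \<and>
        (\<forall>v\<in>insert n Y - insert n R. odd (inc F v) \<longleftrightarrow> p v)"
      by (intro exI[of _ F]) auto
  next
    fix c :: "'a \<Rightarrow> bool"
    assume "\<And>u v. u \<in> insert n Y \<inter> C \<Longrightarrow> v \<in> insert n Y \<inter> C \<Longrightarrow> {u, v} \<in> E \<Longrightarrow> c u \<noteq> c v"
    then obtain d where d: "\<forall>v\<in>R. d v = c v" "\<forall>u\<in>Y. \<forall>v\<in>Y. {u, v} \<in> E \<longrightarrow> d u \<noteq> d v"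
      using colouring_extends[of c] unfolding YC by blast
    show "\<exists>d. (\<forall>v\<in>insert n R. d v = c v) \<and>
        (\<forall>u\<in>insert n Y. \<forall>v\<in>insert n Y. {u, v} \<in> E \<longrightarrow> d u \<noteq> d v)"
    proof (intro exI[of _ "d(n := c n)"] conjI ballI impI)
      fix v assume "v \<in> insert n R"
      then show "(d(n := c n)) v = c v" using d(1) by auto
    next
      fix u v assume uv: "u \<in> insert n Y" "v \<in> insert n Y" "{u, v} \<in> E"
      then have "u \<noteq> n" "v \<noteq> n" using nY' irr by blast+
      then show "(d(n := c n)) u \<noteq> (d(n := c n)) v" using uv d(2) by (metis fun_upd_other insertE)
    qed
  next
    fix v assume "v \<in> insert n Y \<inter> C"
    then show "card (nbrs E v \<inter> (insert n Y \<inter> C)) \<le> 1" using core_Y unfolding YC by blast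
  next
    fix v assume "v \<in> insert n Y"
    then show "nbrs E v \<inter> A \<noteq> {}" using A_dominating nA by blast
  next
    fix v assume "v \<in> A \<inter> C"
    then show "card (nbrs E v \<inter> (A \<inter> C)) \<le> 1" by (rule core_A)
  next
    fix u v assume "u \<in> A" "v \<in> A" "{u, v} \<in> E"
    then show "u \<in> C" by (rule A_edge)
  next
    show "finite (insert n W)" "insert n W = A \<union> insert n Y" "C \<subseteq> insert n W"
      using finite_W W_eq core_subset by auto
    show "A \<inter> insert n Y = {}" using A_Y n W_eq by auto
    show "insert n Y \<inter> C \<subseteq> insert n R" unfolding YC using core_roots by blast
    show "insert n R \<subseteq> insert n Y" using roots_subset by blast
  qed (fact card_edge core_cubic)+
qed

text \<open>The edge to \<open>q\<close> is the only new one inside \<open>Y\<close>. It is selected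
  exactly if \<open>n\<close> needs odd degree, and \<open>n\<close> is coloured opposite to
  \<open>q\<close>.\<close>

lemma decomposed_graph_insert_leaf:
  assumes "decomposed_graph E W A Y C R" and n: "n \<notin> W" and irr: "{n, n} \<notin> E"
    and nA: "nbrs E n \<inter> A \<noteq> {}" and nY: "nbrs E n \<inter> Y = {q}"
  shows "decomposed_graph E (insert n W) A (insert n Y) C R"
proof -
  interpret decomposed_graph E W A Y C R by fact
  have nC: "n \<notin> C" using n core_subset by auto
  then have YC: "insert n Y \<inter> C = Y \<inter> C" by auto
  have q: "q \<in> Y" "{n, q} \<in> E" "q \<noteq> n"
  proof -
    have "q \<in> nbrs E n \<inter> Y" using nY by blast
    then show "q \<in> Y" "{n, q} \<in> E" "q \<noteq> n" using irr by (auto simp: nbrs_def insert_commute)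
  qed
  have nY': "{u, n} \<in> E \<longleftrightarrow> u = q" "{n, u} \<in> E \<longleftrightarrow> u = q" if "u \<in> Y" for u
  proof -
    have "u \<in> nbrs E n \<longleftrightarrow> u = q" using nY that by blast
    then show "{u, n} \<in> E \<longleftrightarrow> u = q" "{n, u} \<in> E \<longleftrightarrow> u = q"
      by (simp_all add: nbrs_def insert_commute)
  qed
  have nnotY: "n \<notin> Y" using n W_eq by auto
  have finY: "finite Y" using finite_W W_eq by auto
  show ?thesis
  proof unfold_locales
    fix p :: "'a \<Rightarrow> bool"
    \<comment> \<open>The demand at \<open>q\<close> is toggled in advance if the edge
      \<open>{n, q}\<close> is going to be added.\<close>
    obtain F where F: "F \<subseteq> E" "F \<subseteq> Pow Y"
      "\<forall>v\<in>Y - R. odd (inc F v) \<longleftrightarrow> (p(q := (p q \<noteq> p n))) v"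
      using parity_subgraph[of "p(q := (p q \<noteq> p n))"] by blast
    have finF: "finite F" using F(2) finY by (meson finite_Pow_iff finite_subset)
    define F' where "F' = (if p n then insert {n, q} F else F)"
    have new: "{n, q} \<notin> F" "{e \<in> F. n \<in> e} = {}" using F(2) nnotY by auto
    have "inc F' v = inc F v" if "v \<noteq> n" "v \<noteq> q" for v
    proof -
      have "{e \<in> F'. v \<in> e} = {e \<in> F. v \<in> e}" using that by (auto simp: F'_def)
      then show ?thesis by (simp add: inc_def)
    qed
    moreover have "inc F' n = of_bool (p n)"
    proof -
      have "{e \<in> F'. n \<in> e} = (if p n then {{n, q}} else {})" using new by (auto simp: F'_def)
      then show ?thesis by (simp add: inc_def)
    qed
    moreover have "inc F' q = inc F q + of_bool (p n)"
    proof -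
      have "{e \<in> F'. q \<in> e} = (if p n then insert {n, q} {e \<in> F. q \<in> e} else {e \<in> F. q \<in> e})"
        by (auto simp: F'_def)
      then show ?thesis using new(1) finF by (simp add: inc_def)
    qed
    ultimately have "odd (inc F' v) \<longleftrightarrow> p v" if "v \<in> insert n Y - R" for v
      using that bspec[OF F(3), of v] q by (cases "v = n"; cases "v = q") auto
    moreover have "F' \<subseteq> E" "F' \<subseteq> Pow (insert n Y)" using F q by (auto simp: F'_def)
    ultimately show "\<exists>F. F \<subseteq> E \<and> F \<subseteq> Pow (insert n Y) \<and> (\<forall>v\<in>insert n Y - R. odd (inc F v) \<longleftrightarrow> p v)"
      by blast
  next
    fix c :: "'a \<Rightarrow> bool"
    assume "\<And>u v. u \<in> insert n Y \<inter> C \<Longrightarrow> v \<in> insert n Y \<inter> C \<Longrightarrow> {u, v} \<in> E \<Longrightarrow> c u \<noteq> c v"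
    then obtain d where d: "\<forall>v\<in>R. d v = c v" "\<forall>u\<in>Y. \<forall>v\<in>Y. {u, v} \<in> E \<longrightarrow> d u \<noteq> d v"
      using colouring_extends[of c] unfolding YC by blast
    show "\<exists>d. (\<forall>v\<in>R. d v = c v) \<and>
        (\<forall>u\<in>insert n Y. \<forall>v\<in>insert n Y. {u, v} \<in> E \<longrightarrow> d u \<noteq> d v)"
    proof (intro exI[of _ "d(n := \<not> d q)"] conjI ballI impI)
      fix v assume "v \<in> R"
      then show "(d(n := \<not> d q)) v = c v" using d(1) nnotY roots_subset by auto
    next
      fix u v assume uv: "u \<in> insert n Y" "v \<in> insert n Y" "{u, v} \<in> E"
      then consider "u = n" "v = q" | "u = q" "v = n" | "u \<in> Y" "v \<in> Y" "u \<noteq> n" "v \<noteq> n"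
        using nY' irr nnotY by blast
      then show "(d(n := \<not> d q)) u \<noteq> (d(n := \<not> d q)) v"
      proof cases
        case 3
        then show ?thesis using uv(3) d(2) by (metis fun_upd_other)
      qed (use q(3) in auto)
    qed
  next
    fix v assume "v \<in> insert n Y \<inter> C"
    then show "card (nbrs E v \<inter> (insert n Y \<inter> C)) \<le> 1" using core_Y unfolding YC by blast
  next
    fix v assume "v \<in> insert n Y"
    then show "nbrs E v \<inter> A \<noteq> {}" using A_dominating nA by blast
  next
    fix v assume "v \<in> A \<inter> C"
    then show "card (nbrs E v \<inter> (A \<inter> C)) \<le> 1" by (rule core_A)
  next
    fix u v assume "u \<in> A" "v \<in> A" "{u, v} \<in> E"
    then show "u \<in> C" by (rule A_edge)
  next
    show "finite (insert n W)" "insert n W = A \<union> insert n Y" "C \<subseteq> insert n W"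
      using finite_W W_eq core_subset by auto
    show "A \<inter> insert n Y = {}" using A_Y n W_eq by auto
    show "insert n Y \<inter> C \<subseteq> R" unfolding YC using core_roots by blast
    show "R \<subseteq> insert n Y" using roots_subset by blast
  qed (fact card_edge core_cubic)+
qed

text \<open>Induction on \<open>W\<close>: if all degrees within \<open>W\<close> are at least 3,
  then \<open>W\<close> is cubic and is itself the core; otherwise a vertex with at most two
  neighbours is removed and put back by one of the three insertion lemmas.\<close>

lemma decomposed_graph_exists:
  assumes G: "finite_simple_graph V E" and mad: "mad V E \<le> 3" and "W \<subseteq> V"
  shows "\<exists>A Y C R. decomposed_graph E W A Y C R"
proof -
  have "finite W" using assms by (auto simp: finite_simple_graph_def intro: finite_subset)
  then show ?thesis using \<open>W \<subseteq> V\<close>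
  proof (induction W rule: finite_psubset_induct)
    case (psubset W)
    show ?case
    proof (cases "\<forall>v\<in>W. 3 \<le> card (nbrs E v \<inter> W)")
      case True
      then show ?thesis
        using decomposed_graph_core[OF G psubset.prems] cubic_if_min_degree_3[OF G mad psubset.prems]
        by blast
    next
      case False
      then obtain n where n: "n \<in> W" "card (nbrs E n \<inter> W) \<le> 2" by fastforce
      then obtain A Y C R where D: "decomposed_graph E (W - {n}) A Y C R"
        using psubset.IH[of "W - {n}"] psubset.prems by blast
      interpret decomposed_graph E "W - {n}" A Y C R by fact
      have W: "W = insert n (W - {n})" using n(1) by auto
      have irr: "{n, n} \<notin> E" using card_edge[of "{n, n}"] by auto
      note fin = finite_nbrs[OF G]
      have "card (nbrs E n \<inter> A) + card (nbrs E n \<inter> Y) = card ((nbrs E n \<inter> A) \<union> (nbrs E n \<inter> Y))"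
        using fin A_Y by (intro card_Un_disjoint[symmetric]) auto
      also have "\<dots> \<le> card (nbrs E n \<inter> W)" using fin W_eq by (intro card_mono) auto
      finally have le: "card (nbrs E n \<inter> A) + card (nbrs E n \<inter> Y) \<le> 2" using n(2) by linarith
      consider "nbrs E n \<inter> A = {}" | "nbrs E n \<inter> A \<noteq> {}" "nbrs E n \<inter> Y = {}"
        | "nbrs E n \<inter> A \<noteq> {}" "nbrs E n \<inter> Y \<noteq> {}" by blast
      then show ?thesis
      proof cases
        case 1
        from decomposed_graph_insert_A[OF D _ irr 1] W show ?thesis by auto
      next
        case 2
        from decomposed_graph_insert_root[OF D _ irr 2] W show ?thesis by auto
      next
        case 3
        then have "card (nbrs E n \<inter> A) > 0" "card (nbrs E n \<inter> Y) > 0"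
          using fin by (auto simp: card_gt_0_iff)
        \<comment> \<open>A neighbour in \<open>A\<close> takes one of the two places, so only one
          is left for \<open>Y\<close>.\<close>
        then have "card (nbrs E n \<inter> Y) = 1" using le by linarith
        then obtain q where "nbrs E n \<inter> Y = {q}" by (auto simp: card_1_singleton_iff)
        from decomposed_graph_insert_leaf[OF D _ irr 3(1) this] W show ?thesis by auto
      qed
    qed
  qed
qed

section \<open>Labelling a decomposed graph\<close>

context decomposed_graph
begin

definition inner_edges :: "'a set set" where
  "inner_edges = {e \<in> E. e \<subseteq> A}"

text \<open>For \<open>y\<close> in \<open>Y \<inter> C\<close> this is the component of
  \<open>y\<close> in the matching induced on \<open>Y \<inter> C\<close>, hence one or two
  vertices.\<close>

definition piece :: "'a \<Rightarrow> 'a set" where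
  "piece y = insert y (nbrs E y \<inter> (Y \<inter> C))"

lemma finite_A: "finite A" and finite_Y: "finite Y"
  using finite_W W_eq by auto

lemma finite_inner_edges: "finite inner_edges"
  by (rule finite_subset[of _ "Pow A"]) (auto simp: inner_edges_def finite_A)

lemma no_loop: "{u, u} \<notin> E"
  using card_edge[of "{u, u}"] by auto

lemma edge_pairE:
  assumes "e \<in> E" "a \<in> e"
  obtains b where "e = {a, b}" "a \<noteq> b"
proof -
  obtain x y where "e = {x, y}" "x \<noteq> y" using card_edge[OF assms(1)] by (auto simp: card_2_iff)
  then show thesis using assms(2) that[of x] that[of y] by (auto simp: insert_commute)
qed

lemma inner_edge_core: "m \<in> inner_edges \<Longrightarrow> m \<subseteq> A \<inter> C"
proof
  fix a assume m: "m \<in> inner_edges" and a: "a \<in> m"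
  then obtain b where b: "m = {a, b}" using edge_pairE[of m a] by (auto simp: inner_edges_def)
  then show "a \<in> A \<inter> C" using m A_edge[of a b] by (auto simp: inner_edges_def)
qed

lemma core_degree_split:
  assumes "v \<in> C"
  shows "card (nbrs E v \<inter> (A \<inter> C)) + card (nbrs E v \<inter> (Y \<inter> C)) = 3"
proof -
  have "nbrs E v \<inter> C = (nbrs E v \<inter> (A \<inter> C)) \<union> (nbrs E v \<inter> (Y \<inter> C))"
    using core_subset W_eq by blast
  moreover have "card ((nbrs E v \<inter> (A \<inter> C)) \<union> (nbrs E v \<inter> (Y \<inter> C)))
      = card (nbrs E v \<inter> (A \<inter> C)) + card (nbrs E v \<inter> (Y \<inter> C))"
    using finite_A finite_Y A_Y by (intro card_Un_disjoint) auto
  ultimately show ?thesis using core_cubic[OF assms] by simp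
qed

text \<open>A common endpoint of two different inner edges would have two neighbours in
  \<open>A \<inter> C\<close>, against \<open>core_A\<close>.\<close>

lemma inner_edges_matching:
  assumes m: "m \<in> inner_edges" "m' \<in> inner_edges" "a \<in> m" "a \<in> m'"
  shows "m = m'"
proof -
  have "m \<in> E" "m' \<in> E" using m by (auto simp: inner_edges_def)
  with m obtain b b' where b: "m = {a, b}" "m' = {a, b'}"
    using edge_pairE[of m a] edge_pairE[of m' a] by metis
  let ?N = "nbrs E a \<inter> (A \<inter> C)"
  have "b \<in> ?N" "b' \<in> ?N" "a \<in> A \<inter> C"
    using m inner_edge_core[OF m(1)] inner_edge_core[OF m(2)] b
    by (auto simp: nbrs_def inner_edges_def insert_commute)
  moreover have "finite ?N" using finite_A by auto
  ultimately have "b = b'" using core_A[of a] card_le_Suc0_iff_eq[of ?N] by (metis One_nat_def)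
  then show ?thesis using b by simp
qed

text \<open>By \<open>core_Y\<close> there is no further neighbour of \<open>y\<close> in
  \<open>Y \<inter> C\<close>. Exchanging the roles shows that adjacent vertices have the same
  piece.\<close>

lemma piece_adjacent:
  assumes "y \<in> Y \<inter> C" "y' \<in> Y \<inter> C" "{y, y'} \<in> E"
  shows "piece y = {y, y'}"
proof -
  let ?N = "nbrs E y \<inter> (Y \<inter> C)"
  have "y' \<in> ?N" using assms by (auto simp: nbrs_def insert_commute)
  moreover have "finite ?N" using finite_Y by auto
  ultimately have "?N = {y'}"
    using core_Y[OF assms(1)] card_le_Suc0_iff_eq[of ?N] by (simp del: Int_iff) blast
  then show ?thesis by (simp add: piece_def)
qed

text \<open>An isolated vertex of the matching has its three core neighbours in \<open>A\<close>,
  while each of two matched vertices has at most two there.\<close>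

lemma card_piece_incidences:
  assumes y: "y \<in> Y \<inter> C"
  shows "card (SIGMA z:piece y. nbrs E z \<inter> (A \<inter> C)) \<le> 4"
proof (cases "nbrs E y \<inter> (Y \<inter> C) = {}")
  case True
  then have "piece y = {y}" by (simp add: piece_def)
  then show ?thesis using core_degree_split[of y] y finite_A by simp
next
  case False
  then obtain y' where y': "y' \<in> Y \<inter> C" "y' \<in> nbrs E y" by blast
  then have adj: "{y, y'} \<in> E" by (simp add: nbrs_def insert_commute)
  have le: "card (nbrs E z \<inter> (A \<inter> C)) \<le> 2"
    if "z \<in> Y \<inter> C" "z' \<in> nbrs E z \<inter> (Y \<inter> C)" for z z'
  proof -
    have "card (nbrs E z \<inter> (Y \<inter> C)) > 0" using that(2) finite_Y by (auto simp: card_gt_0_iff)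
    then show ?thesis using core_degree_split[of z] that(1) by auto
  qed
  have "y \<noteq> y'" using adj no_loop by auto
  then have "card (SIGMA z:piece y. nbrs E z \<inter> (A \<inter> C))
      = card (nbrs E y \<inter> (A \<inter> C)) + card (nbrs E y' \<inter> (A \<inter> C))"
    unfolding piece_adjacent[OF y y'(1) adj] using finite_A by (subst card_SigmaI) auto
  also have "\<dots> \<le> 2 + 2"
    using y y' nbrs_sym[of y' E y] by (intro add_mono le[of y y'] le[of y' y]) auto
  finally show ?thesis by simp
qed

text \<open>Hall's condition holds because an inner edge sends at least four edges into \<open>Y \<inter> C\<close>, while
  at most four edges leave a component of the matching on \<open>Y \<inter> C\<close>.\<close>

lemma inner_edges_assignment:
  obtains \<alpha> \<beta> where "\<And>m. m \<in> inner_edges \<Longrightarrow> \<alpha> m \<in> m \<and> \<beta> m \<in> Y \<inter> C \<and> {\<alpha> m, \<beta> m} \<in> E"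
    "inj_on (\<lambda>m. piece (\<beta> m)) inner_edges"
proof -
  \<comment> \<open>Components rather than vertices are distributed, since a colour prescribed at
    one vertex of a piece fixes that of its partner.\<close>
  define S where "S m = piece ` {y \<in> Y \<inter> C. \<exists>a\<in>m. {a, y} \<in> E}" for m
  have finS: "finite (S m)" for m using finite_Y by (auto simp: S_def)
  have "\<exists>r. inj_on r inner_edges \<and> (\<forall>m\<in>inner_edges. r m \<in> S m)"
  proof (rule hall_marriage)
    fix J assume J: "J \<subseteq> inner_edges"
    have finJ: "finite J" using J finite_inner_edges by (rule finite_subset)
    let ?T = "SIGMA a:\<Union>J. nbrs E a \<inter> (Y \<inter> C)" and ?P = "\<Union>(S ` J)"
    have UJ: "\<Union>J \<subseteq> A \<inter> C" using J inner_edge_core by blast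
    have finUJ: "finite (\<Union>J)" using UJ finite_A by (meson finite_Int finite_subset)
    have "card (\<Union>J) = (\<Sum>m\<in>J. card m)"
    proof (rule card_Union_disjoint)
      show "pairwise disjnt J"
      proof (rule pairwiseI)
        fix m m' assume "m \<in> J" "m' \<in> J" "m \<noteq> m'"
        then show "disjnt m m'" using J inner_edges_matching[of m m'] by (auto simp: disjnt_iff)
      qed
    next
      fix m assume "m \<in> J"
      then show "finite m" using finUJ by (meson Union_upper finite_subset)
    qed
    also have "\<dots> = (\<Sum>m\<in>J. 2)"
      using J card_edge by (intro sum.cong) (auto simp: inner_edges_def)
    finally have cJ: "card (\<Union>J) = 2 * card J" by simp
    \<comment> \<open>Double counting: each of the \<open>2 * card J\<close> endpoints has at least
      two neighbours in \<open>Y \<inter> C\<close>; the resulting pairs are then reversed and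
      grouped by the component of the vertex in \<open>Y\<close>.\<close>
    have "4 * card J = (\<Sum>a\<in>\<Union>J. 2)" using cJ by simp
    also have "\<dots> \<le> (\<Sum>a\<in>\<Union>J. card (nbrs E a \<inter> (Y \<inter> C)))"
    proof (rule sum_mono)
      fix a assume "a \<in> \<Union>J"
      then have "a \<in> A \<inter> C" using UJ by blast
      then show "2 \<le> card (nbrs E a \<inter> (Y \<inter> C))" using core_A[of a] core_degree_split[of a] by auto
    qed
    also have "\<dots> = card ?T" using finUJ finite_Y by (subst card_SigmaI) auto
    also have "\<dots> = card (prod.swap ` ?T)" by (simp add: card_image)
    also have "\<dots> \<le> card (\<Union>P\<in>?P. SIGMA z:P. nbrs E z \<inter> (A \<inter> C))"
    proof (rule card_mono)
      show "finite (\<Union>P\<in>?P. SIGMA z:P. nbrs E z \<inter> (A \<inter> C))"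
        by (rule finite_subset[of _ "Y \<times> A"]) (auto simp: S_def piece_def finite_Y finite_A)
      show "prod.swap ` ?T \<subseteq> (\<Union>P\<in>?P. SIGMA z:P. nbrs E z \<inter> (A \<inter> C))"
      proof
        fix x assume "x \<in> prod.swap ` ?T"
        then obtain m a y where x: "x = (y, a)" "m \<in> J" "a \<in> m" "y \<in> nbrs E a" "y \<in> Y \<inter> C" by auto
        then have "{a, y} \<in> E" "a \<in> nbrs E y" by (auto simp: nbrs_def insert_commute)
        moreover have "y \<in> piece y" by (simp add: piece_def)
        moreover have "a \<in> A \<inter> C" using x UJ by blast
        moreover have "piece y \<in> S m" using x \<open>{a, y} \<in> E\<close> by (auto simp: S_def)
        ultimately show "x \<in> (\<Union>P\<in>?P. SIGMA z:P. nbrs E z \<inter> (A \<inter> C))" using x by blast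
      qed
    qed
    also have "\<dots> \<le> (\<Sum>P\<in>?P. card (SIGMA z:P. nbrs E z \<inter> (A \<inter> C)))"
      using finJ finS by (intro card_UN_le) auto
    also have "\<dots> \<le> (\<Sum>P\<in>?P. 4)"
      using card_piece_incidences by (intro sum_mono) (auto simp: S_def)
    finally show "card J \<le> card ?P" by simp
  qed (use finite_inner_edges finS in auto)
  then obtain r where r: "inj_on r inner_edges" "\<forall>m\<in>inner_edges. r m \<in> S m" by blast
  \<comment> \<open>The component assigned to \<open>m\<close> is turned back into an edge from an
    endpoint of \<open>m\<close> to one of its vertices.\<close>
  have "\<forall>m\<in>inner_edges. \<exists>x. fst x \<in> m \<and> snd x \<in> Y \<inter> C \<and> {fst x, snd x} \<in> E \<and> r m = piece (snd x)"
  proof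
    fix m assume "m \<in> inner_edges"
    then obtain a y where "a \<in> m" "y \<in> Y \<inter> C" "{a, y} \<in> E" "r m = piece y"
      using r(2) unfolding S_def by blast
    then show "\<exists>x. fst x \<in> m \<and> snd x \<in> Y \<inter> C \<and> {fst x, snd x} \<in> E \<and> r m = piece (snd x)"
      by (intro exI[of _ "(a, y)"]) simp
  qed
  then obtain x where x: "\<forall>m\<in>inner_edges. fst (x m) \<in> m \<and> snd (x m) \<in> Y \<inter> C
      \<and> {fst (x m), snd (x m)} \<in> E \<and> r m = piece (snd (x m))"
    by (rule bchoice[THEN exE])
  show thesis
  proof (rule that[of "fst \<circ> x" "snd \<circ> x"])
    show "inj_on (\<lambda>m. piece ((snd \<circ> x) m)) inner_edges" using r(1) x by (simp add: inj_on_def)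
  qed (use x in auto)
qed

text \<open>By injectivity each piece carries at most one prescription
  \<open>b1 (\<beta> m)\<close>, and a partner takes the opposite colour. Together with
  \<open>b0\<close> on the other roots this extends to \<open>Y\<close>.\<close>

lemma root_colouring:
  fixes b0 b1 :: "'a \<Rightarrow> bool"
  assumes \<beta>: "\<And>m. m \<in> inner_edges \<Longrightarrow> \<beta> m \<in> Y \<inter> C"
    and inj: "inj_on (\<lambda>m. piece (\<beta> m)) inner_edges"
  obtains d where "\<And>m. m \<in> inner_edges \<Longrightarrow> d (\<beta> m) = b1 (\<beta> m)"
    "\<And>v. v \<in> R - C \<Longrightarrow> d v = b0 v"
    "\<And>u v. u \<in> Y \<Longrightarrow> v \<in> Y \<Longrightarrow> {u, v} \<in> E \<Longrightarrow> d u \<noteq> d v"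
proof -
  \<comment> \<open>The representative is shared by the vertices of a piece and equals
    \<open>\<beta> m\<close> if the piece is assigned to \<open>m\<close>.\<close>
  have "\<forall>P\<in>piece ` (Y \<inter> C). \<exists>y\<in>P. \<forall>m\<in>inner_edges. piece (\<beta> m) = P \<longrightarrow> y = \<beta> m"
  proof
    fix P assume P: "P \<in> piece ` (Y \<inter> C)"
    show "\<exists>y\<in>P. \<forall>m\<in>inner_edges. piece (\<beta> m) = P \<longrightarrow> y = \<beta> m"
    proof (cases "\<exists>m\<in>inner_edges. piece (\<beta> m) = P")
      case True
      then obtain m where m: "m \<in> inner_edges" "piece (\<beta> m) = P" by blast
      then have "\<beta> m \<in> P" by (auto simp: piece_def)
      moreover have "m' = m" if "m' \<in> inner_edges" "piece (\<beta> m') = P" for m'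
        using inj_onD[OF inj _ that(1) m(1)] that m by simp
      ultimately show ?thesis by blast
    next
      case False
      then show ?thesis using P by (auto simp: piece_def)
    qed
  qed
  then obtain rep where rep: "\<forall>P\<in>piece ` (Y \<inter> C). rep P \<in> P \<and>
      (\<forall>m\<in>inner_edges. piece (\<beta> m) = P \<longrightarrow> rep P = \<beta> m)"
    unfolding Bex_def by (rule bchoice[THEN exE])
  \<comment> \<open>In the core the representative receives its value of \<open>b1\<close> and a
    partner the negation.\<close>
  define c where "c v = (if v \<notin> C then b0 v else (v = rep (piece v)) = b1 (rep (piece v)))" for v
  have "c u \<noteq> c v" if uv: "u \<in> Y \<inter> C" "v \<in> Y \<inter> C" "{u, v} \<in> E" for u v
  proof -
    have P: "piece u = {u, v}" "piece v = {u, v}"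
      using piece_adjacent[OF uv] piece_adjacent[OF uv(2,1)] uv(3) by (auto simp: insert_commute)
    have "rep (piece u) \<in> piece u" using rep uv(1) by blast
    then have "rep {u, v} = u \<or> rep {u, v} = v" using P by simp
    moreover have "u \<noteq> v" using uv(3) no_loop by auto
    ultimately show ?thesis using uv P by (auto simp: c_def)
  qed
  from colouring_extends[of c, OF this] obtain d where
    d: "\<forall>v\<in>R. d v = c v" "\<forall>u\<in>Y. \<forall>v\<in>Y. {u, v} \<in> E \<longrightarrow> d u \<noteq> d v" by blast
  show thesis
  proof (rule that)
    fix m assume m: "m \<in> inner_edges"
    then have "rep (piece (\<beta> m)) = \<beta> m" using rep \<beta>[OF m] by blast
    then have "c (\<beta> m) = b1 (\<beta> m)" using \<beta>[OF m] by (simp add: c_def)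
    then show "d (\<beta> m) = b1 (\<beta> m)" using d(1) \<beta>[OF m] core_roots by blast
  next
    fix v assume v: "v \<in> R - C"
    then show "d v = b0 v" using bspec[OF d(1), of v] by (simp add: c_def)
  next
    fix u v assume "u \<in> Y" "v \<in> Y" "{u, v} \<in> E"
    then show "d u \<noteq> d v" using d(2) by blast
  qed
qed

text \<open>\<open>X\<close> is the set of edges labelled 2 and \<open>c\<close> is 1 at the
  vertices labelled 2. Parity separates \<open>A\<close> from \<open>Y\<close>, residues modulo 4
  separate neighbours inside \<open>Y\<close>, and the set \<open>H\<close> takes care of the edges
  inside \<open>A\<close>.\<close>

lemma proper_labelling:
  obtains X c where "X \<subseteq> E" "\<And>v. c v \<le> (1::nat)"
    "\<And>u v. u \<in> W \<Longrightarrow> v \<in> W \<Longrightarrow> {u, v} \<in> E \<Longrightarrow> inc X u + c u \<noteq> inc X v + c v"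
proof -

  \<comment> \<open>Endpoints and private neighbours of the inner edges\<close>
  obtain \<alpha> \<beta> where \<alpha>\<beta>:
    "\<And>m. m \<in> inner_edges \<Longrightarrow> \<alpha> m \<in> m \<and> \<beta> m \<in> Y \<inter> C \<and> {\<alpha> m, \<beta> m} \<in> E"
    and inj: "inj_on (\<lambda>m. piece (\<beta> m)) inner_edges"
    using inner_edges_assignment by blast
  have \<beta>_inj: "m = m'" if "m \<in> inner_edges" "m' \<in> inner_edges" "\<beta> m = \<beta> m'" for m m'
    using inj_onD[OF inj _ that(1,2)] that(3) by simp
  have "\<forall>m\<in>inner_edges. \<exists>g. m = {\<alpha> m, g} \<and> \<alpha> m \<noteq> g"
    using \<alpha>\<beta> by (metis (no_types, lifting) edge_pairE inner_edges_def mem_Collect_eq)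
  then obtain \<gamma> where "\<forall>m\<in>inner_edges. m = {\<alpha> m, \<gamma> m} \<and> \<alpha> m \<noteq> \<gamma> m"
    by (rule bchoice[THEN exE])
  then have \<gamma>: "{\<alpha> m, \<gamma> m} = m" "\<alpha> m \<noteq> \<gamma> m" if "m \<in> inner_edges" for m
    using that by (blast, blast)
  have \<alpha>A: "\<alpha> m \<in> A" and \<gamma>A: "\<gamma> m \<in> A" if "m \<in> inner_edges" for m
    using \<gamma>(1)[OF that] that by (auto simp: inner_edges_def)

  \<comment> \<open>Target values on \<open>Y\<close> modulo 4\<close>
  obtain F where F: "F \<subseteq> E" "F \<subseteq> Pow Y" "\<forall>v\<in>Y - R. odd (inc F v)"
    using parity_subgraph[of "\<lambda>_. True"] by auto
  \<comment> \<open>True stands for the target 1 and false for the target 3 modulo 4. The residues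
    are chosen so that the missing amount \<open>f\<close>, defined below, is 1 or 2 at
    \<open>\<beta> m\<close> and 0 or 1 at roots outside \<open>C\<close>.\<close>
  obtain d where d_\<beta>: "\<And>m. m \<in> inner_edges \<Longrightarrow> d (\<beta> m) \<longleftrightarrow> inc F (\<beta> m) mod 4 \<in> {0, 3}"
    and d_root: "\<And>v. v \<in> R - C \<Longrightarrow> d v \<longleftrightarrow> inc F v mod 4 \<in> {0, 1}"
    and d: "\<And>u v. u \<in> Y \<Longrightarrow> v \<in> Y \<Longrightarrow> {u, v} \<in> E \<Longrightarrow> d u \<noteq> d v"
    by (rule root_colouring[of \<beta> "\<lambda>v. inc F v mod 4 \<in> {0, 3}" "\<lambda>v. inc F v mod 4 \<in> {0, 1}"])
      (use \<alpha>\<beta> inj in auto)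
  \<comment> \<open>The sum at \<open>v \<in> Y\<close> will be \<open>inc F v + f v\<close>, which is 1 or 3 modulo 4 according to \<open>d v\<close>.\<close>
  define f where "f v = ((if d v then 1 else 3) + 3 * inc F v) mod 4" for v
  \<comment> \<open>The term \<open>3 * inc F v\<close> in \<open>f\<close> acts as minus
    \<open>inc F v\<close> modulo 4.\<close>
  have mod4: "(inc F v + f v) mod 4 = (if d v then 1 else 3)" for v
    unfolding f_def by (cases "d v") (simp_all, presburger+)
  have f_le: "f v \<le> 3" for v
  proof -
    have "f v < 4" by (simp add: f_def)
    then show ?thesis by simp
  qed
  have f_\<beta>: "f (\<beta> m) = 1 \<or> f (\<beta> m) = 2" if "m \<in> inner_edges" for m
    unfolding f_def d_\<beta>[OF that] by (simp; presburger)
  have f_root: "f v \<le> 1" if "v \<in> R - C" for v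
    unfolding f_def d_root[OF that] by (simp; presburger)
  \<comment> \<open>An odd target minus an odd degree is even, which leaves 0 or 2.\<close>
  have f_leaf: "f v \<le> 2" if "v \<in> Y - R" for v
  proof -
    have "odd (inc F v)" using F(3) that by blast
    then show ?thesis unfolding f_def by (cases "d v") (simp_all, presburger+)
  qed

  \<comment> \<open>Selected edges between \<open>Y\<close> and \<open>A\<close>\<close>
  define U where "U v = (nbrs E v \<inter> A) - {\<alpha> m | m. m \<in> inner_edges \<and> \<beta> m = v}" for v
  have finU: "finite (U v)" for v using finite_A by (auto simp: U_def)
  \<comment> \<open>All but one unit of \<open>f v\<close> must come from edges to \<open>A\<close>,
    where the edge to \<open>\<alpha> m\<close> is reserved if \<open>v = \<beta> m\<close>. A
    private neighbour needs at most one such edge, another core vertex at most two, any other vertex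
    at most one. Truncated subtraction makes the demand 0 when \<open>f v = 0\<close>.\<close>
  have f_U: "f v - 1 \<le> card (U v)" if v: "v \<in> Y" for v
  proof (cases "\<exists>m\<in>inner_edges. \<beta> m = v")
    case True
    then obtain m where m: "m \<in> inner_edges" "\<beta> m = v" by blast
    then have "U v = (nbrs E v \<inter> A) - {\<alpha> m}" using \<beta>_inj unfolding U_def by blast
    then have "card (nbrs E v \<inter> A) - 1 \<le> card (U v)"
      by (metis diff_card_le_card_Diff finite.emptyI finite.insertI is_singletonI is_singleton_altdef)
    moreover have "2 \<le> card (nbrs E v \<inter> (A \<inter> C))"
      using core_degree_split[of v] core_Y[of v] \<alpha>\<beta>[OF m(1)] m(2) by auto
    moreover have "card (nbrs E v \<inter> (A \<inter> C)) \<le> card (nbrs E v \<inter> A)"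
      using finite_A by (intro card_mono) auto
    ultimately show ?thesis using f_\<beta>[OF m(1)] m(2) by auto
  next
    case False
    then have U: "U v = nbrs E v \<inter> A" by (auto simp: U_def)
    show ?thesis
    proof (cases "v \<in> C")
      case True
      then have "2 \<le> card (nbrs E v \<inter> (A \<inter> C))"
        using core_degree_split[of v] core_Y[of v] v by auto
      also have "\<dots> \<le> card (nbrs E v \<inter> A)" using finite_A by (intro card_mono) auto
      finally show ?thesis using f_le[of v] U by simp
    next
      case False
      then have "f v \<le> 2" using f_root[of v] f_leaf[of v] v by force
      moreover have "card (U v) > 0" using A_dominating[OF v] finU[of v] U by (simp add: card_gt_0_iff)
      ultimately show ?thesis by linarith
    qed
  qed
  have "\<forall>v\<in>Y. \<exists>L. L \<subseteq> U v \<and> card L = f v - 1"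
    using f_U by (meson obtain_subset_with_card_n)
  then obtain L where L: "\<forall>v\<in>Y. L v \<subseteq> U v \<and> card (L v) = f v - 1"
    by (rule bchoice[THEN exE])
  have LA: "a \<in> A" "{a, v} \<in> E" if "v \<in> Y" "a \<in> L v" for a v
    using L that by (auto simp: U_def nbrs_def)
  have L\<alpha>: "\<alpha> m \<notin> L (\<beta> m)" if "m \<in> inner_edges" for m
  proof -
    have "\<alpha> m \<notin> U (\<beta> m)" using that by (auto simp: U_def)
    then show ?thesis using L \<alpha>\<beta>[OF that] by blast
  qed

  \<comment> \<open>Switching edges for the conflicts inside \<open>A\<close>\<close>
  define q where "q a = card {v \<in> Y. a \<in> L v}" for a
  \<comment> \<open>\<open>Z\<close> makes the sum at \<open>\<alpha> m\<close> even before the edge from \<open>\<alpha> m\<close> to \<open>\<beta> m\<close> is added, so adding that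
    edge (for \<open>m \<in> H\<close>) raises the final value at \<open>\<alpha> m\<close> by 2. It changes nothing at \<open>\<gamma> m\<close>, and
    at \<open>\<beta> m\<close> it is compensated by the label of \<open>\<beta> m\<close>.\<close>
  define Z where "Z = {m \<in> inner_edges. odd (q (\<alpha> m))}"
  define z where "z m = (of_bool (m \<in> Z) :: nat)" for m
  \<comment> \<open>The left side is the final sum at \<open>\<gamma> m\<close>, the right side the
    sum at \<open>\<alpha> m\<close> without the additional edge, so \<open>H\<close> collects the
    inner edges in conflict.\<close>
  define H where "H = {m \<in> inner_edges.
    q (\<gamma> m) + z m + (q (\<gamma> m) + z m) mod 2 = q (\<alpha> m) + z m}"
  define X where "X = F \<union> {{u, v} | u v. v \<in> Y \<and> u \<in> L v} \<union> {{\<alpha> m, \<beta> m} | m. m \<in> H} \<union> Z"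
  have HM: "H \<subseteq> inner_edges" and ZM: "Z \<subseteq> inner_edges" by (auto simp: H_def Z_def)
  have \<beta>Y: "\<beta> m \<in> Y" if "m \<in> H" for m using \<alpha>\<beta> HM that by blast
  have \<alpha>AH: "\<alpha> m \<in> A" if "m \<in> H" for m using \<alpha>A HM that by blast
  have XE: "X \<subseteq> E"
    using F(1) LA(2) \<alpha>\<beta> HM ZM by (auto simp: X_def inner_edges_def)

  \<comment> \<open>Degrees in the selected edge set\<close>
  have inc_X: "inc X v = card (nbrs X v)" for v
    using XE card_edge by (intro inc_eq_card_nbrs) auto
  have notA: "v \<notin> A" if "v \<in> Y" for v using A_Y that by blast
  have nbrs_Y: "nbrs X v = nbrs F v \<union> L v \<union> {\<alpha> m | m. m \<in> H \<and> \<beta> m = v}" if v: "v \<in> Y" for v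
  proof -
    have 1: "{u, v} \<notin> Z" for u using ZM notA[OF v] by (auto simp: inner_edges_def)
    have 2: "(\<exists>u' v'. {u, v} = {u', v'} \<and> v' \<in> Y \<and> u' \<in> L v') \<longleftrightarrow> u \<in> L v" for u
      using notA[OF v] LA(1) v by (metis doubleton_eq_iff)
    have 3: "(\<exists>m. {u, v} = {\<alpha> m, \<beta> m} \<and> m \<in> H) \<longleftrightarrow> (\<exists>m. u = \<alpha> m \<and> m \<in> H \<and> \<beta> m = v)" for u
      using notA[OF v] \<alpha>AH by (metis doubleton_eq_iff)
    show ?thesis using 1 2 3 by (simp add: nbrs_def X_def set_eq_iff)
  qed
  have nbrs_A: "nbrs X a = {v \<in> Y. a \<in> L v} \<union> {\<beta> m | m. m \<in> H \<and> \<alpha> m = a} \<union> nbrs Z a"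
    if a: "a \<in> A" for a
  proof -
    have aY: "a \<notin> Y" using A_Y a by blast
    have 1: "{u, a} \<notin> F" for u using F(2) aY by auto
    have 2: "(\<exists>u' v'. {u, a} = {u', v'} \<and> v' \<in> Y \<and> u' \<in> L v') \<longleftrightarrow> u \<in> Y \<and> a \<in> L u" for u
      using aY by (metis doubleton_eq_iff)
    have 3: "(\<exists>m. {u, a} = {\<alpha> m, \<beta> m} \<and> m \<in> H) \<longleftrightarrow> (\<exists>m. u = \<beta> m \<and> m \<in> H \<and> \<alpha> m = a)" for u
      using aY \<beta>Y by (metis doubleton_eq_iff)
    show ?thesis using 1 2 3 by (simp add: nbrs_def X_def set_eq_iff)
  qed
  \<comment> \<open>The shortfall is 0 or 1, so the vertex label can supply it. At
    \<open>\<beta> m\<close> with \<open>m \<in> H\<close> the additional edge replaces the label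
    without overshooting, because \<open>f (\<beta> m)\<close> is not 0.\<close>
  have inc_Y: "inc X v \<le> inc F v + f v \<and> inc F v + f v \<le> inc X v + 1" if v: "v \<in> Y" for v
  proof -
    let ?B = "{\<alpha> m | m. m \<in> H \<and> \<beta> m = v}"
    have sub: "nbrs F v \<subseteq> Y" "L v \<subseteq> A" "?B \<subseteq> A"
      using F(2) LA(1)[OF v] \<alpha>AH by (auto simp: nbrs_def)
    have fin: "finite (nbrs F v)" "finite (L v)" "finite ?B"
      using sub finite_A finite_Y by (meson finite_subset)+
    have "card (nbrs X v) = card (nbrs F v) + card (L v \<union> ?B)"
      unfolding nbrs_Y[OF v] Un_assoc using fin sub A_Y by (intro card_Un_disjoint) auto
    also have "card (L v \<union> ?B) = card (L v) + card ?B"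
      using fin L\<alpha> HM by (intro card_Un_disjoint) auto
    finally have eq: "inc X v = inc F v + (f v - 1) + card ?B"
      using L v F(1) card_edge inc_X by (subst inc_eq_card_nbrs[of F]) auto
    show ?thesis
    proof (cases "\<exists>m\<in>H. \<beta> m = v")
      case True
      then obtain m where m: "m \<in> H" "\<beta> m = v" by blast
      then have "?B = {\<alpha> m}" using \<beta>_inj HM by blast
      moreover have "f v = 1 \<or> f v = 2" using f_\<beta>[of m] m HM by blast
      ultimately show ?thesis using eq by auto
    next
      case False
      then have "?B = {}" by blast
      then show ?thesis using eq by (simp only: card.empty) linarith
    qed
  qed
  \<comment> \<open>As the inner edges form a matching, only \<open>m\<close> itself contributes
    through \<open>H\<close> and \<open>Z\<close>; the edge to \<open>\<beta> m\<close> is not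
    already counted by \<open>q\<close>.\<close>
  have inc_\<alpha>: "inc X (\<alpha> m) = q (\<alpha> m) + of_bool (m \<in> H) + z m" if m: "m \<in> inner_edges" for m
  proof -
    have "{\<beta> m' | m'. m' \<in> H \<and> \<alpha> m' = \<alpha> m} = (if m \<in> H then {\<beta> m} else {})"
    proof -
      have "m' = m" if "m' \<in> H" "\<alpha> m' = \<alpha> m" for m'
        using inner_edges_matching[of m' m "\<alpha> m"] \<alpha>\<beta>[of m'] \<alpha>\<beta>[OF m] m HM that
        by (metis subsetD)
      then have "{\<beta> m' | m'. m' \<in> H \<and> \<alpha> m' = \<alpha> m} = {\<beta> m' | m'. m' = m \<and> m \<in> H}" by blast
      then show ?thesis by simp
    qed
    moreover have "nbrs Z (\<alpha> m) = (if m \<in> Z then {\<gamma> m} else {})"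
    proof -
      have eq: "{\<gamma> m, \<alpha> m} = m" using \<gamma>(1)[OF m] by (simp add: insert_commute)
      have "u = \<gamma> m \<and> m \<in> Z" if "{u, \<alpha> m} \<in> Z" for u
      proof -
        have "\<alpha> m \<in> m" using eq by blast
        then have "{u, \<alpha> m} = m" using inner_edges_matching[of "{u, \<alpha> m}" m "\<alpha> m"] that ZM m by blast
        then show ?thesis using eq that by (metis doubleton_eq_iff)
      qed
      then show ?thesis using eq by (auto simp: nbrs_def)
    qed
    ultimately have "nbrs X (\<alpha> m) = {v \<in> Y. \<alpha> m \<in> L v} \<union> ((if m \<in> H then {\<beta> m} else {})
        \<union> (if m \<in> Z then {\<gamma> m} else {}))" using nbrs_A[OF \<alpha>A[OF m]] by (simp add: Un_assoc)
    moreover have "\<beta> m \<in> Y" "\<gamma> m \<notin> Y" "\<beta> m \<noteq> \<gamma> m"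
      using \<alpha>\<beta>[OF m] \<gamma>A[OF m] A_Y by auto
    ultimately show ?thesis
      using L\<alpha>[OF m] finite_Y by (auto simp: inc_X q_def z_def)
  qed
  \<comment> \<open>Being the unchosen end of its only inner edge, \<open>\<gamma> m\<close> meets
    no edge added for \<open>H\<close>.\<close>
  have inc_\<gamma>: "inc X (\<gamma> m) = q (\<gamma> m) + z m" if m: "m \<in> inner_edges" for m
  proof -
    have mem: "\<gamma> m \<in> m" "\<alpha> m \<noteq> \<gamma> m" using \<gamma>[OF m] by blast+
    have "\<alpha> m' \<noteq> \<gamma> m" if "m' \<in> H" for m'
    proof
      assume eq: "\<alpha> m' = \<gamma> m"
      have "m' \<in> inner_edges" using that HM by blast
      then have "m' = m" using inner_edges_matching[of m' m "\<gamma> m"] m mem(1) \<alpha>\<beta>[of m'] eq by simp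
      then show False using eq mem(2) by simp
    qed
    then have "{\<beta> m' | m'. m' \<in> H \<and> \<alpha> m' = \<gamma> m} = {}" by auto
    moreover have "nbrs Z (\<gamma> m) = (if m \<in> Z then {\<alpha> m} else {})"
    proof -
      have eq: "{\<alpha> m, \<gamma> m} = m" using \<gamma>(1)[OF m] by (simp add: insert_commute)
      have "u = \<alpha> m \<and> m \<in> Z" if "{u, \<gamma> m} \<in> Z" for u
      proof -
        have "\<gamma> m \<in> m" using eq by blast
        then have "{u, \<gamma> m} = m" using inner_edges_matching[of "{u, \<gamma> m}" m "\<gamma> m"] that ZM m by blast
        then show ?thesis using eq that by (metis doubleton_eq_iff)
      qed
      then show ?thesis using eq by (auto simp: nbrs_def)
    qed
    ultimately have "nbrs X (\<gamma> m) = {v \<in> Y. \<gamma> m \<in> L v} \<union> (if m \<in> Z then {\<alpha> m} else {})"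
      unfolding nbrs_A[OF \<gamma>A[OF m]] by (simp only: Un_empty_right)
    moreover have "\<alpha> m \<notin> Y" using \<alpha>A[OF m] A_Y by auto
    ultimately show ?thesis using finite_Y by (auto simp: inc_X q_def z_def)
  qed

  \<comment> \<open>Vertex labels and separation of adjacent sums\<close>
  define c where "c v = (if v \<in> Y then inc F v + f v - inc X v else inc X v mod 2)" for v
  define t where "t v = inc X v + c v" for v
  have t_Y: "t v = inc F v + f v" if "v \<in> Y" for v
    using inc_Y[OF that] that by (simp add: t_def c_def)
  \<comment> \<open>On \<open>A\<close> the vertex label rounds an odd number of selected edges up
    to an even sum.\<close>
  have t_A: "t a = inc X a + inc X a mod 2" if "a \<in> A" for a
    using that A_Y by (auto simp: t_def c_def)
  have odd_Y: "odd (t v)" if "v \<in> Y" for v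
    using mod4[of v] unfolding t_Y[OF that] by (cases "d v") (simp_all, presburger+)
  have even_A: "even (t a)" if "a \<in> A" for a
    unfolding t_A[OF that] by presburger
  have t_inner: "t (\<alpha> m) \<noteq> t (\<gamma> m)" if m: "m \<in> inner_edges" for m
  proof -
    have even: "even (q (\<alpha> m) + z m)" using m by (simp add: z_def Z_def)
    have "t (\<gamma> m) = q (\<gamma> m) + z m + (q (\<gamma> m) + z m) mod 2"
      using t_A[OF \<gamma>A[OF m]] inc_\<gamma>[OF m] by simp
    then have "m \<in> H \<longleftrightarrow> t (\<gamma> m) = q (\<alpha> m) + z m" using m by (simp add: H_def)
    \<comment> \<open>For \<open>m \<in> H\<close> the additional edge makes the degree odd, so
      rounding up adds a second unit.\<close>
    moreover have "t (\<alpha> m) = q (\<alpha> m) + z m + 2 * of_bool (m \<in> H)"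
      unfolding t_A[OF \<alpha>A[OF m]] inc_\<alpha>[OF m] using even by (cases "m \<in> H") (simp; presburger)+
    ultimately show ?thesis by auto
  qed
  show thesis
  proof (rule that)
    show "X \<subseteq> E" by (rule XE)
    show "c v \<le> 1" for v using inc_Y[of v] by (auto simp: c_def)
    fix u v assume uv: "u \<in> W" "v \<in> W" "{u, v} \<in> E"
    then consider "u \<in> Y" "v \<in> Y" | "u \<in> A" "v \<in> Y" | "u \<in> Y" "v \<in> A" | "u \<in> A" "v \<in> A"
      using W_eq by blast
    then have "t u \<noteq> t v"
    proof cases
      case 1
      then have "d u \<noteq> d v" using d uv(3) by blast
      then have "(inc F u + f u) mod 4 \<noteq> (inc F v + f v) mod 4" unfolding mod4 by simp
      then show ?thesis using t_Y 1 by metis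
    next
      case 4
      then have m: "{u, v} \<in> inner_edges" using uv(3) by (simp add: inner_edges_def)
      then have "{u, v} = {\<alpha> {u, v}, \<gamma> {u, v}}" using \<gamma>(1) by blast
      then show ?thesis using t_inner[OF m] by (metis doubleton_eq_iff)
    qed (use odd_Y even_A in metis)+
    then show "inc X u + c u \<noteq> inc X v + c v" by (simp add: t_def)
  qed
qed

end

text \<open>Sum minus size measures by how much the labels exceed 1 in total. Hence equal multisets
  force equal values of \<open>inc X v + c v\<close>.\<close>

lemma sum_mset_label_mset:
  assumes "finite E" "X \<subseteq> E"
  shows "sum_mset (label_mset E (case_sum (\<lambda>v. 1 + c v) (\<lambda>e. if e \<in> X then 2 else 1)) v)
    = size (label_mset E (case_sum (\<lambda>v. 1 + c v) (\<lambda>e. if e \<in> X then 2 else 1)) v) + (inc X v + c v)"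
proof -
  let ?S = "{e \<in> E. v \<in> e}"
  have "(\<Sum>e\<in>?S. if e \<in> X then 2 else 1) = (\<Sum>e\<in>?S. 1 + of_bool (e \<in> X) :: nat)"
    by (intro sum.cong) auto
  also have "\<dots> = card ?S + card (?S \<inter> X)"
    using assms(1) by (subst sum.distrib) (simp add: of_bool_def sum.If_cases)
  also have "?S \<inter> X = {e \<in> X. v \<in> e}" using assms(2) by auto
  finally show ?thesis by (simp add: label_mset_def inc_def sum_unfold_sum_mset)
qed

theorem theorem1p4:
  fixes V :: "'a set" and E :: "'a set set"
  assumes "finite_simple_graph V E"
    and "mad V E \<le> 3"
  shows "chi_total_M V E \<le> 2
    \<and> (\<exists>l. l \<in> (V <+> E) \<rightarrow> {1, 2} \<and>
          (\<forall>u v. {u, v} \<in> E \<longrightarrow> label_mset E l u \<noteq> label_mset E l v))"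
proof -
  obtain A Y C R where "decomposed_graph E V A Y C R"
    using decomposed_graph_exists[OF assms, of V] by blast
  then obtain X and c :: "'a \<Rightarrow> nat" where X: "X \<subseteq> E" and c: "\<And>v. c v \<le> 1"
    and proper: "\<And>u v. u \<in> V \<Longrightarrow> v \<in> V \<Longrightarrow> {u, v} \<in> E \<Longrightarrow> inc X u + c u \<noteq> inc X v + c v"
    using decomposed_graph.proper_labelling by blast
  define l where "l = case_sum (\<lambda>v. 1 + c v) (\<lambda>e. if e \<in> X then 2 else (1::nat))"
  have "l x \<in> {1, 2}" for x
  proof (cases x)
    case (Inl v)
    then show ?thesis using c[of v] by (auto simp: l_def)
  qed (simp add: l_def)
  then have l: "l \<in> (V <+> E) \<rightarrow> {1, 2}" by blast
  have neq: "label_mset E l u \<noteq> label_mset E l v" if uv: "{u, v} \<in> E" for u v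
  proof
    assume eq: "label_mset E l u = label_mset E l v"
    have "sum_mset (label_mset E l w) = size (label_mset E l w) + (inc X w + c w)" for w
      unfolding l_def using finite_simple_graph_finite_edges[OF assms(1)] X by (rule sum_mset_label_mset)
    from this[of u] this[of v] have "inc X u + c u = inc X v + c v" using eq by simp
    moreover have "u \<in> V" "v \<in> V" using assms(1) uv by (auto simp: finite_simple_graph_def)
    ultimately show False using proper uv by blast
  qed
  have "{1..2} = {1, 2::nat}" by auto
  then have "chi_total_M V E \<le> 2"
    unfolding chi_total_M_def total_labelling_def multiset_proper_def
    using l neq by (intro Least_le conjI exI[of _ l]) auto
  then show ?thesis using l neq by blast
qed

end
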